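(* Let $N,M$ be positive integers, let $\mathcal A,\mathcal M\in\mathbb C^{N\times N}$ with $\mathcal A$ Hermitian positive semi-definite and $\mathcal M$ Hermitian positive definite, let $\mathcal B\in\mathbb C^{N\times M}$ satisfy $\mathcal A\mathcal M^{-1}\mathcal B=0$, let $\mathcal U\in\mathbb C^{M\times M}$ be Hermitian positive definite, let $c>0$ be real, and let $\mathcal F\in\mathbb C^N$. Suppose $\dim\mathbb C_0\neq 0$, and let $\mathcal H\in\mathbb C^{N\times\dim\mathbb C_0}$ be a matrix whose columns form an $\mathcal M$-orthonormal basis of $\mathbb C_0$ (equivalently, of the eigenspace for the zero eigenvalue of $(\mathcal A+\mathcal B\mathcal U\mathcal B^* )u=\lambda\mathcal M u$). Then the constrained system $$(\mathcal A+c\mathcal M)u+\mathcal B p=\mathcal F,\qquad \mathcal B^* u=0\qquad (u\in\mathbb C^N,\ p\in\mathbb C^M)$$ has a solution $(u,p)$ whose component $u$ is unique, and this $u$ is obtained as follows: there is a unique $\tilde u\in\mathbb C^N$ with $$(\mathcal A+\mathcal B\mathcal U\mathcal B^*+\mathcal M\mathcal H\mathcal H^*\mathcal M)\tilde u=\mathcal F,$$ and then $u$ is the unique solution in $\mathbb C^N$ of $$(\mathcal A+c\mathcal M)u=\mathcal F-\mathcal B\mathcal U\mathcal B^*\tilde u.$$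
   Context: $X^*$ denotes the conjugate transpose of a matrix $X$. $\mathbb C_0:=\operatorname{Ker}\mathcal A\cap\operatorname{Ker}(\mathcal B\mathcal U\mathcal B^* )\subset\mathbb C^N$. $\mathcal M$-orthonormal means orthonormal for the inner product $(v,w)\mapsto w^*\mathcal M v$, i.e. $\mathcal H^*\mathcal M\mathcal H=I$. *)

theory Defs
  imports "HOL-Analysis.Analysis"
begin

definition ctranspose :: "complex ^ 'n ^ 'm \<Rightarrow> complex ^ 'm ^ 'n" where
  "ctranspose X = (\<chi> i j. cnj (X $ j $ i))"

definition hermitian :: "complex ^ 'n ^ 'n \<Rightarrow> bool" where
  "hermitian X \<longleftrightarrow> ctranspose X = X"

text \<open>The scalar \<open>w\<^sup>* X v\<close>, linear in \<open>v\<close> and conjugate-linear in \<open>w\<close>.\<close>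

definition sesq :: "complex ^ 'n ^ 'n \<Rightarrow> complex ^ 'n \<Rightarrow> complex ^ 'n \<Rightarrow> complex" where
  "sesq X v w = (\<Sum>i\<in>UNIV. cnj (w $ i) * (X *v v) $ i)"

text \<open>For Hermitian \<open>X\<close> the value \<open>v\<^sup>* X v\<close> is real, so taking the real part below loses nothing.\<close>

definition hermitian_psd :: "complex ^ 'n ^ 'n \<Rightarrow> bool" where
  "hermitian_psd X \<longleftrightarrow> hermitian X \<and> (\<forall>v. 0 \<le> Re (sesq X v v))"

definition hermitian_pd :: "complex ^ 'n ^ 'n \<Rightarrow> bool" where
  "hermitian_pd X \<longleftrightarrow> hermitian X \<and> (\<forall>v. v \<noteq> 0 \<longrightarrow> 0 < Re (sesq X v v))"

definition Ker :: "complex ^ 'n ^ 'm \<Rightarrow> (complex ^ 'n) set" where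
  "Ker X = {v. X *v v = 0}"

definition C0 ::
  "complex ^ 'n ^ 'n \<Rightarrow> complex ^ 'm ^ 'n \<Rightarrow> complex ^ 'm ^ 'm \<Rightarrow> (complex ^ 'n) set" where
  "C0 A B U = Ker A \<inter> Ker (B ** U ** ctranspose B)"

definition gen_eigenspace ::
  "complex ^ 'n ^ 'n \<Rightarrow> complex ^ 'n ^ 'n \<Rightarrow> complex \<Rightarrow> (complex ^ 'n) set" where
  "gen_eigenspace X M l = {v. X *v v = l *s (M *v v)}"

text \<open>The constants \<open>vec.independent\<close>, \<open>vec.span\<close> and \<open>vec.dim\<close> refer to the complex
  vector space structure (scalar multiplication \<open>*s\<close>), unlike the unqualified versions,
  which are over the reals. Injectivity rules out repeated columns, which the set
  \<open>columns H\<close> does not see.\<close>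

definition orthonormal_basis_columns ::
  "complex ^ 'n ^ 'n \<Rightarrow> complex ^ 'k ^ 'n \<Rightarrow> (complex ^ 'n) set \<Rightarrow> bool" where
  "orthonormal_basis_columns M H S \<longleftrightarrow>
     inj (\<lambda>j. column j H) \<and> vec.independent (columns H) \<and> vec.span (columns H) = S \<and>
     ctranspose H ** M ** H = mat 1"

definition constrained_system ::
  "complex ^ 'n ^ 'n \<Rightarrow> complex ^ 'n ^ 'n \<Rightarrow> complex ^ 'm ^ 'n \<Rightarrow> real \<Rightarrow> complex ^ 'n
    \<Rightarrow> complex ^ 'n \<Rightarrow> complex ^ 'm \<Rightarrow> bool" where
  "constrained_system A M B c F u p \<longleftrightarrow>
     (A + c *\<^sub>R M) *v u + B *v p = F \<and> ctranspose B *v u = 0"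

end

theory Submission
  imports Defs
begin

text \<open>Write \<open>K = B U B\<^sup>*\<close>. Since \<open>A M\<^sup>-\<^sup>1 K = 0\<close>, an equation \<open>(A + K) v = 0\<close> multiplied by
  \<open>A M\<^sup>-\<^sup>1\<close> gives \<open>A M\<^sup>-\<^sup>1 A v = 0\<close>, hence \<open>A v = 0\<close> and \<open>K v = 0\<close>; positivity of \<open>U\<close> then gives
  \<open>B\<^sup>* v = 0\<close>. In particular \<open>A H = 0\<close> and \<open>B\<^sup>* H = 0\<close>, so multiplying the augmented equation by
  \<open>H\<^sup>*\<close> shows that the augmented matrix is injective. Multiplying
  \<open>(A + c M) u = F - K ut = A ut + M H H\<^sup>* M ut\<close> by \<open>B\<^sup>* M\<^sup>-\<^sup>1\<close> yields \<open>c B\<^sup>* u = 0\<close>, so \<open>u\<close>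
  solves the constrained system with \<open>p = U B\<^sup>* ut\<close>.\<close>

section \<open>Conjugate transposes and the sesquilinear form\<close>

lemma ctranspose_ctranspose [simp]: "ctranspose (ctranspose X) = X"
  by (simp add: ctranspose_def vec_eq_iff)

lemma ctranspose_zero [simp]: "ctranspose 0 = 0"
  by (simp add: ctranspose_def vec_eq_iff)

lemma ctranspose_mat_1 [simp]: "ctranspose (mat 1) = mat 1"
  by (auto simp add: ctranspose_def mat_def vec_eq_iff)

lemma ctranspose_mult: "ctranspose (X ** Y) = ctranspose Y ** ctranspose X"
  by (simp add: ctranspose_def matrix_matrix_mult_def vec_eq_iff mult.commute)

lemma sesq_eq_zero: "X *v v = 0 \<Longrightarrow> sesq X v w = 0"
  by (simp add: sesq_def)

text \<open>The adjoint relation, by exchanging the two sums. It is written with explicit sums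
  because \<open>Y\<close> may be rectangular, whereas \<open>sesq\<close> takes a square
  matrix.\<close>

lemma sum_cnj_ctranspose:
  "(\<Sum>i\<in>UNIV. cnj (w $ i) * (ctranspose Y *v x) $ i) = (\<Sum>j\<in>UNIV. cnj ((Y *v w) $ j) * x $ j)"
proof -
  have "(\<Sum>i\<in>UNIV. cnj (w $ i) * (ctranspose Y *v x) $ i)
      = (\<Sum>i\<in>UNIV. \<Sum>j\<in>UNIV. cnj (Y $ j $ i) * cnj (w $ i) * x $ j)"
    by (simp add: ctranspose_def matrix_vector_mult_def sum_distrib_left mult_ac)
  also have "\<dots> = (\<Sum>j\<in>UNIV. \<Sum>i\<in>UNIV. cnj (Y $ j $ i) * cnj (w $ i) * x $ j)"
    by (rule sum.swap)
  also have "\<dots> = (\<Sum>j\<in>UNIV. cnj ((Y *v w) $ j) * x $ j)"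
    by (simp add: matrix_vector_mult_def sum_distrib_right)
  finally show ?thesis .
qed

lemma sesq_congruence: "sesq (ctranspose Y ** X ** Y) v w = sesq X (Y *v v) (Y *v w)"
  by (simp add: sesq_def sum_cnj_ctranspose flip: matrix_vector_mul_assoc)

text \<open>Pairing the equation with \<open>v\<close> gives the form of \<open>X\<close> at
  \<open>Y *v v\<close>, and definiteness excludes the value 0 at a nonzero vector.\<close>

lemma hermitian_pd_congruence_kernel:
  assumes "hermitian_pd X" and "(ctranspose Y ** X ** Y) *v v = 0"
  shows "Y *v v = 0"
proof (rule ccontr)
  assume "Y *v v \<noteq> 0"
  then have "0 < Re (sesq X (Y *v v) (Y *v v))"
    using assms(1) by (simp add: hermitian_pd_def)
  moreover have "sesq X (Y *v v) (Y *v v) = 0"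
    using sesq_eq_zero[OF assms(2), of v] by (simp add: sesq_congruence)
  ultimately show False by simp
qed

lemma hermitian_pd_kernel:
  assumes "hermitian_pd X" and "X *v v = 0"
  shows "v = 0"
  using hermitian_pd_congruence_kernel[of X "mat 1" v] assms by simp

section \<open>Invertibility, real scaling and definiteness\<close>

lemma invertible_if_kernel_trivial:
  fixes X :: "complex ^ 'n ^ 'n"
  assumes "\<And>v. X *v v = 0 \<Longrightarrow> v = 0"
  shows "invertible X"
  unfolding invertible_left_inverse matrix_left_invertible_ker using assms by blast

lemma matrix_inv_right_left:
  assumes "invertible X"
  shows "X ** matrix_inv X = mat 1" and "matrix_inv X ** X = mat 1"
  using someI_ex[OF assms[unfolded invertible_def]] by (auto simp: matrix_inv_def)

lemma scaleR_matrix_vector_mult: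
  fixes X :: "complex ^ 'n ^ 'm"
  shows "(c *\<^sub>R X) *v v = c *\<^sub>R (X *v v)"
  by (simp add: matrix_vector_mult_def vec_eq_iff scaleR_sum_right)

lemma matrix_vector_mult_scaleR_right:
  fixes X :: "complex ^ 'n ^ 'm"
  shows "X *v (c *\<^sub>R v) = c *\<^sub>R (X *v v)"
  by (simp add: matrix_vector_mult_def vec_eq_iff scaleR_sum_right)

lemma column_matrix_mult: "column j (X ** Y) = X *v column j Y"
  by (simp add: column_def matrix_matrix_mult_def matrix_vector_mult_def vec_eq_iff)

lemma invertible_solution_unique:
  fixes X :: "complex ^ 'n ^ 'n"
  assumes "invertible X"
  shows "\<exists>!v. X *v v = F"
proof -
  have "v = matrix_inv X *v F \<longleftrightarrow> X *v v = F" for v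
    using matrix_inv_right_left[OF assms]
    by (metis matrix_vector_mul_assoc matrix_vector_mul_lid)
  then show ?thesis by metis
qed

text \<open>Transposing both inverse identities shows that \<open>ctranspose (matrix_inv M)\<close>
  also inverts \<open>M\<close>, and inverses are unique.\<close>

lemma hermitian_matrix_inv:
  assumes "hermitian M" and "invertible M"
  shows "hermitian (matrix_inv M)"
proof -
  have "M ** matrix_inv M = mat 1" "matrix_inv M ** M = mat 1"
    using matrix_inv_right_left[OF assms(2)] by auto
  then show ?thesis
    using assms(1) unfolding hermitian_def
    by (metis ctranspose_mult ctranspose_mat_1 matrix_mul_assoc matrix_mul_lid matrix_mul_rid)
qed

text \<open>Serves twice: for the unique solvability of the equation for \<open>u\<close>, and for
  the uniqueness of \<open>u\<close> in the constrained system.\<close>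

lemma hermitian_pd_add_scaled:
  assumes A: "hermitian_psd A" and M: "hermitian_pd M" and c: "c > 0"
  shows "hermitian_pd (A + c *\<^sub>R M)"
proof -
  have "sesq (A + c *\<^sub>R M) v v = sesq A v v + of_real c * sesq M v v" for v
    by (simp add: sesq_def matrix_vector_mult_add_rdistrib scaleR_matrix_vector_mult
        scaleR_conv_of_real[where 'a = complex] distrib_left sum.distrib sum_distrib_left mult_ac)
  moreover have "hermitian (A + c *\<^sub>R M)"
    using A M unfolding hermitian_psd_def hermitian_pd_def hermitian_def
    by (simp add: ctranspose_def vec_eq_iff)
  ultimately show ?thesis
    using A M c unfolding hermitian_psd_def hermitian_pd_def
    by (simp add: add_nonneg_pos)
qed

section \<open>Matrices with orthonormal columns\<close>

lemma orthonormal_basis_columns_reproducing: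
  assumes "orthonormal_basis_columns M H S" and "v \<in> S"
  shows "H *v (ctranspose H *v (M *v v)) = v"
proof -
  let ?P = "H ** (ctranspose H ** M)"
  have H: "v \<in> vec.span (columns H)" "ctranspose H ** M ** H = mat 1"
    using assms by (auto simp: orthonormal_basis_columns_def)
  \<comment> \<open>\<open>?P\<close> fixes each column of \<open>H\<close>, and its fixed vectors
    form a complex subspace, so it fixes the whole span.\<close>
  have "?P ** H = H"
    using H(2) by (simp flip: matrix_mul_assoc)
  then have "columns H \<subseteq> {w. ?P *v w = w}"
    by (auto simp: columns_def simp flip: column_matrix_mult)
  moreover have "vec.subspace {w. ?P *v w = w}"
    by (simp add: vec.subspace_def matrix_vector_right_distrib vector_scalar_commute)
  ultimately have "vec.span (columns H) \<subseteq> {w. ?P *v w = w}"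
    by (rule vec.span_minimal)
  then show ?thesis
    using H(1) by (auto simp: matrix_vector_mul_assoc)
qed

lemma orthonormal_basis_columns_annihilate:
  assumes "orthonormal_basis_columns M H S" and "\<And>v. v \<in> S \<Longrightarrow> X *v v = 0"
  shows "X ** H = 0"
proof -
  have "X *v column j H = 0" for j
  proof -
    have "column j H \<in> vec.span (columns H)"
      by (intro vec.span_base) (auto simp: columns_def)
    then show ?thesis
      using assms by (simp add: orthonormal_basis_columns_def)
  qed
  then have "column j (X ** H) = 0" for j
    by (simp add: column_matrix_mult)
  then show ?thesis
    by (simp add: column_def vec_eq_iff)
qed

section \<open>The coupling condition and the kernels it controls\<close>

lemma coupling_adjoint:
  assumes "hermitian A" and "hermitian M" and "invertible M" and "A ** matrix_inv M ** B = 0"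
  shows "ctranspose B ** matrix_inv M ** A = 0"
proof -
  have "ctranspose (A ** matrix_inv M ** B) = 0"
    using assms(4) by simp
  then show ?thesis
    using assms(1) hermitian_matrix_inv[OF assms(2,3)]
    by (simp add: ctranspose_mult hermitian_def matrix_mul_assoc)
qed

text \<open>Definiteness of \<open>U\<close> removes \<open>U\<close> from the description of
  \<open>C0\<close>; this form later yields \<open>A ** H = 0\<close> and
  \<open>ctranspose B ** H = 0\<close>.\<close>

lemma C0_eq:
  assumes "hermitian_pd U"
  shows "C0 A B U = {v. A *v v = 0 \<and> ctranspose B *v v = 0}"
proof -
  have "ctranspose B *v v = 0" if "(B ** U ** ctranspose B) *v v = 0" for v
    using hermitian_pd_congruence_kernel[of U "ctranspose B" v] assms that by simp
  moreover have "(B ** U ** ctranspose B) *v v = 0" if "ctranspose B *v v = 0" for v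
    using that by (simp flip: matrix_vector_mul_assoc)
  ultimately show ?thesis
    by (auto simp: C0_def Ker_def)
qed

lemma kernel_sum_eq_C0:
  assumes A: "hermitian A" and M: "hermitian_pd M" and AB: "A ** matrix_inv M ** B = 0"
  shows "Ker (A + B ** U ** ctranspose B) = C0 A B U"
proof -
  let ?K = "B ** U ** ctranspose B"
  have inv: "invertible M"
    using hermitian_pd_kernel[OF M] by (rule invertible_if_kernel_trivial)
  then have MI: "M ** matrix_inv M = mat 1"
    by (rule matrix_inv_right_left)
  have "A *v v = 0" if v: "A *v v + ?K *v v = 0" for v
  proof -
    have "(A ** matrix_inv M) *v (?K *v v) = (A ** matrix_inv M ** B) *v (U *v (ctranspose B *v v))"
      by (simp add: matrix_vector_mul_assoc matrix_mul_assoc)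
    moreover have "(A ** matrix_inv M) *v (A *v v + ?K *v v) = 0"
      by (simp add: v)
    ultimately have "(A ** matrix_inv M ** A) *v v = 0"
      by (simp add: AB matrix_vector_right_distrib matrix_vector_mul_assoc)
    \<comment> \<open>Since \<open>A\<close> and \<open>matrix_inv M\<close> are Hermitian,
      \<open>A ** matrix_inv M ** A\<close> is a congruence of \<open>M\<close>, so its kernel lies
      in that of \<open>matrix_inv M ** A\<close>.\<close>
    moreover have "ctranspose (matrix_inv M ** A) ** M ** (matrix_inv M ** A)
        = A ** matrix_inv M ** (M ** matrix_inv M) ** A"
      using A M hermitian_matrix_inv[OF _ inv]
      by (simp add: ctranspose_mult hermitian_def hermitian_pd_def matrix_mul_assoc)
    ultimately have "(matrix_inv M ** A) *v v = 0"
      using hermitian_pd_congruence_kernel[OF M, of "matrix_inv M ** A" v] MI by simp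
    then have "M *v ((matrix_inv M ** A) *v v) = 0"
      by simp
    then show ?thesis
      by (simp add: matrix_vector_mul_assoc matrix_mul_assoc MI)
  qed
  then show ?thesis
    by (fastforce simp: Ker_def C0_def matrix_vector_mult_add_rdistrib)
qed

lemma augmented_kernel_trivial:
  assumes A: "hermitian A" and M: "hermitian_pd M" and AB: "A ** matrix_inv M ** B = 0"
    and U: "hermitian_pd U" and H: "orthonormal_basis_columns M H (C0 A B U)"
    and v: "(A + B ** U ** ctranspose B + M ** H ** ctranspose H ** M) *v v = 0"
  shows "v = 0"
proof -
  have "A ** H = 0" "ctranspose B ** H = 0"
    using H by (auto intro!: orthonormal_basis_columns_annihilate simp: C0_eq[OF U])
  then have "ctranspose (A ** H) = 0" "ctranspose (ctranspose B ** H) = 0"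
    by simp_all
  then have HA: "ctranspose H ** A = 0" and HB: "ctranspose H ** B = 0"
    using A by (simp_all add: ctranspose_mult hermitian_def)
  have HMH: "ctranspose H ** M ** H = mat 1"
    using H by (simp add: orthonormal_basis_columns_def)
  have "ctranspose H ** (A + B ** U ** ctranspose B + M ** H ** ctranspose H ** M)
      = ctranspose H ** A + ctranspose H ** B ** U ** ctranspose B
        + ctranspose H ** M ** H ** ctranspose H ** M"
    by (simp add: matrix_add_ldistrib matrix_mul_assoc)
  then have "ctranspose H ** (A + B ** U ** ctranspose B + M ** H ** ctranspose H ** M)
      = ctranspose H ** M"
    by (simp add: HA HB HMH)
  then have HMv: "ctranspose H *v (M *v v) = 0"
    by (metis v matrix_vector_mul_assoc matrix_vector_mult_0_right)
  then have "(M ** H ** ctranspose H ** M) *v v = 0"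
    by (simp flip: matrix_vector_mul_assoc)
  then have "v \<in> Ker (A + B ** U ** ctranspose B)"
    using v by (simp add: Ker_def matrix_vector_mult_add_rdistrib)
  then have "v \<in> C0 A B U"
    by (simp add: kernel_sum_eq_C0[OF A M AB])
  \<comment> \<open>A vector of \<open>C0\<close> is recovered from its coordinates
    \<open>ctranspose H *v (M *v v)\<close>, which vanish by \<open>HMv\<close>.\<close>
  from orthonormal_basis_columns_reproducing[OF H this] show ?thesis
    by (simp add: HMv)
qed

section \<open>Solutions of the constrained system\<close>

lemma constrained_system_if_augmented:
  assumes A: "hermitian A" and M: "hermitian_pd M" and AB: "A ** matrix_inv M ** B = 0"
    and U: "hermitian_pd U" and c: "c \<noteq> 0"
    and H: "orthonormal_basis_columns M H (C0 A B U)"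
    and ut: "(A + B ** U ** ctranspose B + M ** H ** ctranspose H ** M) *v ut = F"
    and u: "(A + c *\<^sub>R M) *v u = F - (B ** U ** ctranspose B) *v ut"
  shows "constrained_system A M B c F u (U *v (ctranspose B *v ut))"
proof -
  let ?L = "ctranspose B ** matrix_inv M"
  have inv: "invertible M"
    using hermitian_pd_kernel[OF M] by (rule invertible_if_kernel_trivial)
  then have IM: "matrix_inv M ** M = mat 1"
    by (rule matrix_inv_right_left)
  have LA: "?L ** A = 0"
    using coupling_adjoint[OF A _ inv AB] M by (simp add: hermitian_pd_def)
  have LM: "?L ** M = ctranspose B"
    by (simp add: IM flip: matrix_mul_assoc)
  have BH: "ctranspose B ** H = 0"
    using H by (auto intro!: orthonormal_basis_columns_annihilate simp: C0_eq[OF U])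
  \<comment> \<open>Replacing \<open>F\<close> by the augmented equation cancels the term
    \<open>B ** U ** ctranspose B\<close>.\<close>
  have "A *v u + c *\<^sub>R (M *v u) = A *v ut + (M ** H ** ctranspose H ** M) *v ut"
    using u by (simp add: matrix_vector_mult_add_rdistrib scaleR_matrix_vector_mult flip: ut)
  \<comment> \<open>\<open>?L\<close> annihilates both \<open>A\<close> terms and turns
    \<open>M ** H\<close> into \<open>ctranspose B ** H\<close>, which is 0.\<close>
  then have "?L *v (A *v u) + c *\<^sub>R (?L *v (M *v u))
      = ?L *v (A *v ut) + ?L *v ((M ** H ** ctranspose H ** M) *v ut)"
    by (metis matrix_vector_right_distrib matrix_vector_mult_scaleR_right)
  then have "c *\<^sub>R (ctranspose B *v u) = 0"
    by (simp add: matrix_vector_mul_assoc matrix_mul_assoc LA LM BH)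
  then have "ctranspose B *v u = 0"
    using c by simp
  then show ?thesis
    using u by (simp add: constrained_system_def matrix_vector_mul_assoc matrix_mul_assoc)
qed

text \<open>Pairing the difference of the first equations with \<open>u - v\<close> moves
  \<open>B\<close> onto \<open>u - v\<close> as \<open>ctranspose B\<close>, where the constraint
  gives 0; definiteness concludes. The components \<open>p\<close> and \<open>q\<close> may still
  differ by a vector in the kernel of \<open>B\<close>.\<close>

lemma constrained_system_unique:
  assumes pd: "hermitian_pd (A + c *\<^sub>R M)"
    and "constrained_system A M B c F u p" and "constrained_system A M B c F v q"
  shows "u = v"
proof -
  let ?X = "A + c *\<^sub>R M"
  have eq: "?X *v (u - v) = B *v (q - p)" and B: "ctranspose B *v (u - v) = 0"
    using assms(2,3)
    by (auto simp: constrained_system_def matrix_vector_mult_diff_distrib algebra_simps)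
  have "sesq ?X (u - v) (u - v) = (\<Sum>j\<in>UNIV. cnj ((ctranspose B *v (u - v)) $ j) * (q - p) $ j)"
    using sum_cnj_ctranspose[of "u - v" "ctranspose B" "q - p"]
    by (simp only: sesq_def eq ctranspose_ctranspose)
  also have "\<dots> = 0"
    by (simp add: B)
  finally show ?thesis
    using pd unfolding hermitian_pd_def by (metis less_irrefl right_minus_eq zero_complex.sel(1))
qed

theorem mainTheorem5:
  fixes A M :: "complex ^ 'n ^ 'n"
    and B :: "complex ^ 'm ^ 'n"
    and U :: "complex ^ 'm ^ 'm"
    and H :: "complex ^ 'k ^ 'n"
    and F :: "complex ^ 'n"
    and c :: real
  assumes "hermitian_psd A"
    and "hermitian_pd M"
    and "A ** matrix_inv M ** B = 0"
    and "hermitian_pd U"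
    and "c > 0"
    and "vec.dim (C0 A B U) \<noteq> 0"
    and "CARD('k) = vec.dim (C0 A B U)"
    and "orthonormal_basis_columns M H (C0 A B U)"
  shows "gen_eigenspace (A + B ** U ** ctranspose B) M 0 = C0 A B U
    \<and> (\<exists>!u. \<exists>p. constrained_system A M B c F u p)
    \<and> (\<exists>!ut. (A + B ** U ** ctranspose B + M ** H ** ctranspose H ** M) *v ut = F)
    \<and> (\<forall>ut. (A + B ** U ** ctranspose B + M ** H ** ctranspose H ** M) *v ut = F \<longrightarrow>
          (\<exists>!u. (A + c *\<^sub>R M) *v u = F - (B ** U ** ctranspose B) *v ut)
        \<and> (\<forall>u. (A + c *\<^sub>R M) *v u = F - (B ** U ** ctranspose B) *v ut \<longrightarrow>
              (\<exists>p. constrained_system A M B c F u p)))"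
proof -
  let ?K = "B ** U ** ctranspose B"
  let ?S = "A + ?K + M ** H ** ctranspose H ** M"
  have A: "hermitian A"
    using assms(1) by (simp add: hermitian_psd_def)
  have pd: "hermitian_pd (A + c *\<^sub>R M)"
    using assms(1,2,5) by (rule hermitian_pd_add_scaled)
  have eig: "gen_eigenspace (A + ?K) M 0 = C0 A B U"
    using kernel_sum_eq_C0[OF A assms(2,3)] by (simp add: gen_eigenspace_def Ker_def)
  have ex_ut: "\<exists>!ut. ?S *v ut = F"
    using augmented_kernel_trivial[OF A assms(2,3,4,8)]
    by (intro invertible_solution_unique invertible_if_kernel_trivial)
  have ex_u: "\<exists>!u. (A + c *\<^sub>R M) *v u = G" for G
    using hermitian_pd_kernel[OF pd]
    by (intro invertible_solution_unique invertible_if_kernel_trivial)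
  have solves: "\<exists>p. constrained_system A M B c F u p"
    if "?S *v ut = F" "(A + c *\<^sub>R M) *v u = F - ?K *v ut" for ut u
    using constrained_system_if_augmented[OF A assms(2,3,4) _ assms(8) that] assms(5) by auto
  \<comment> \<open>Existence comes from the two-stage construction through \<open>ut\<close>,
    uniqueness from definiteness.\<close>
  have "\<exists>!u. \<exists>p. constrained_system A M B c F u p"
    using ex_ut ex_u solves constrained_system_unique[OF pd] by metis
  then show ?thesis
    by (intro conjI allI impI eig ex_ut ex_u solves)
qed

end
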